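(* Let $\theta_0,\theta_1$ be two worlds with exactly the same evidence law, $Q_{\theta_0,n}=Q_{\theta_1,n}$, and with unique oracle actions $\mathcal{A}^*(\theta_0)=\{a_0^*\}$ and $\mathcal{A}^*(\theta_1)=\{a_1^*\}$ satisfying $a_0^*\neq a_1^*$. Then every (possibly randomized) selector $s$ based only on $Z_n$ has average oracle-action error under the equal prior at least $1/2$: $$\tfrac12\,\mathbb{P}_{\theta_0}\bigl(s(Z_n)\neq a_0^*\bigr)+\tfrac12\,\mathbb{P}_{\theta_1}\bigl(s(Z_n)\neq a_1^*\bigr)\ \ge\ \tfrac12 .$$ Moreover, if $\Delta>0$ is such that every non-oracle action costs at least $\Delta$ extra risk, i.e. $R_{\theta_j}(a)-R_{\theta_j}(a_j^* )\ge\Delta$ for $j\in\{0,1\}$ and all $a\in\mathcal{A}$ with $a\neq a_j^*$, then every such selector has average oracle regret $$\tfrac12\operatorname{Reg}_{\theta_0}(s)+\tfrac12\operatorname{Reg}_{\theta_1}(s)\ \ge\ \frac{\Delta}{2}.$$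
   Context: $\mathcal{A}$ is a finite nonempty set of actions. Each world $\theta$ assigns to every action $a\in\mathcal{A}$ a real risk $R_\theta(a)$, and the oracle action set is $\mathcal{A}^*(\theta)=\arg\min_{a\in\mathcal{A}}R_\theta(a)$. In world $\theta$ an observation (the evidence) $Z_n$ is generated, with values in a measurable space; its probability law is denoted $Q_{\theta,n}$. A selector $s$ based only on $Z_n$ is a (possibly randomized) measurable rule which outputs an action $s(Z_n)\in\mathcal{A}$: a Markov kernel from the evidence space to $\mathcal{A}$, the same kernel in every world. Its oracle regret in world $\theta$ is $\operatorname{Reg}_\theta(s)=\mathbb{E}_\theta\bigl[R_\theta(s(Z_n))-\min_{a\in\mathcal{A}}R_\theta(a)\bigr]$, where the expectation is over $Z_n\sim Q_{\theta,n}$ and the internal randomization of $s$. *)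

theory Defs
  imports "HOL-Probability.Probability"
begin

definition oracle_actions :: "'a set \<Rightarrow> ('a \<Rightarrow> real) \<Rightarrow> 'a set" where
  "oracle_actions A r = {a. is_arg_min r (\<lambda>b. b \<in> A) a}"

text \<open>
  A randomized selector is a Markov kernel from the evidence space \<open>E\<close> to the action set \<open>A\<close>,
  the latter carrying the discrete sigma-algebra; \<open>prob_algebra\<close> forces every \<open>s z\<close> with
  \<open>z \<in> space E\<close> to have total mass one. The kernel takes no world as an argument.
\<close>

definition selectors :: "'z measure \<Rightarrow> 'a set \<Rightarrow> ('z \<Rightarrow> 'a measure) set" where
  "selectors E A = E \<rightarrow>\<^sub>M prob_algebra (count_space A)"

text \<open>
  The law of the selected action: first draw the evidence from \<open>Q\<close>, then draw the action from
  the kernel at that evidence. Errors and regrets depend on evidence and internal randomization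
  only through the selected action, so their probabilities and expectations are taken under it.
\<close>

definition action_law :: "'z measure \<Rightarrow> ('z \<Rightarrow> 'a measure) \<Rightarrow> 'a measure" where
  "action_law Q s = Q \<bind> s"

definition error_prob :: "'a set \<Rightarrow> 'z measure \<Rightarrow> ('z \<Rightarrow> 'a measure) \<Rightarrow> 'a \<Rightarrow> real" where
  "error_prob A Q s b = measure (action_law Q s) {a \<in> A. a \<noteq> b}"

definition oracle_regret ::
  "'a set \<Rightarrow> ('a \<Rightarrow> real) \<Rightarrow> 'z measure \<Rightarrow> ('z \<Rightarrow> 'a measure) \<Rightarrow> real" where
  "oracle_regret A r Q s = (\<integral>a. r a - Min (r ` A) \<partial>action_law Q s)"

end

theory Submission
  imports Defs
begin

text \<open>
  Both worlds have the same evidence law, so a selector induces the same law \<open>M\<close> of the chosen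
  action in both. As \<open>a\<^sub>0 \<noteq> a\<^sub>1\<close>, the two error events cover the action set, so their
  \<open>M\<close>-probabilities sum to at least one. The regret integrand dominates \<open>\<Delta>\<close> times the
  indicator of the error event, which reduces the regret bound to the error bound.
\<close>

text \<open>The kernel is measurable with respect to \<open>E\<close>, so
  \<open>sets Q = sets E\<close> is what lets the bind with \<open>Q\<close> be formed inside
  \<open>prob_algebra\<close>. The discrete sigma-algebra on the result makes every error event and
  every regret integrand measurable later on.\<close>

lemma action_law_prob:
  assumes "prob_space Q" and "sets Q = sets E" and "s \<in> selectors E A"
  shows "prob_space (action_law Q s)" and "sets (action_law Q s) = Pow A"
    and "space (action_law Q s) = A"
proof -
  have Q: "Q \<in> space (prob_algebra E)"
    using assms by (simp add: space_prob_algebra)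
  have s: "s \<in> E \<rightarrow>\<^sub>M prob_algebra (count_space A)"
    using assms by (simp add: selectors_def)
  show "prob_space (action_law Q s)"
    unfolding action_law_def by (rule prob_space_bind'[OF Q s])
  show sets: "sets (action_law Q s) = Pow A"
    unfolding action_law_def using sets_bind'[OF Q s] by simp
  show "space (action_law Q s) = A"
    using sets_eq_imp_space_eq[of "action_law Q s" "count_space A"] sets by simp
qed

lemma error_prob_add_ge_1:
  assumes "prob_space Q" and "sets Q = sets E" and "s \<in> selectors E A" and "a \<noteq> b"
  shows "1 \<le> error_prob A Q s a + error_prob A Q s b"
proof -
  note M = action_law_prob[OF assms(1-3)]
  interpret prob_space "action_law Q s" by (rule M)
  have "1 = prob A"
    using prob_space M(3) by simp
  also have "A = {c \<in> A. c \<noteq> a} \<union> {c \<in> A. c \<noteq> b}"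
    using \<open>a \<noteq> b\<close> by auto
  also have "prob \<dots> \<le> prob {c \<in> A. c \<noteq> a} + prob {c \<in> A. c \<noteq> b}"
    by (rule measure_Un_le) (auto simp: M(2))
  finally show ?thesis
    by (simp add: error_prob_def)
qed

lemma Min_image_oracle_actions:
  fixes r :: "'a \<Rightarrow> real"
  assumes "finite A" and "b \<in> oracle_actions A r"
  shows "Min (r ` A) = r b"
  using assms by (intro Min_eqI) (auto simp: oracle_actions_def is_arg_min_linorder)

text \<open>The comparison is pointwise: at \<open>b\<close> the excess risk and the indicator both
  vanish, and at any other action of \<open>A\<close> the gap hypothesis applies. Integrating turns
  the indicator into the error probability.\<close>

lemma oracle_regret_ge_error_prob:
  fixes r :: "'a \<Rightarrow> real"
  assumes "prob_space Q" and "sets Q = sets E" and "s \<in> selectors E A"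
    and "finite A" and "b \<in> oracle_actions A r"
    and gap: "\<forall>a\<in>A. a \<noteq> b \<longrightarrow> r a - r b \<ge> \<Delta>"
  shows "\<Delta> * error_prob A Q s b \<le> oracle_regret A r Q s"
proof -
  let ?M = "action_law Q s" and ?B = "{a \<in> A. a \<noteq> b}"
  note M = action_law_prob[OF assms(1-3)]
  interpret prob_space ?M by (rule M)
  \<comment> \<open>Stated for arbitrary \<open>f\<close> so that it serves both sides of
    \<open>integral_mono\<close>. Finiteness of \<open>A\<close> supplies the bound, discreteness
    the measurability.\<close>
  have int: "integrable ?M f" for f :: "'a \<Rightarrow> real"
  proof (rule integrable_const_bound)
    show "AE a in ?M. norm (f a) \<le> Max ((\<lambda>a. norm (f a)) ` A)"
      using \<open>finite A\<close> by (intro AE_I2) (auto simp: M(3))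
    show "f \<in> borel_measurable ?M"
      by (auto simp: measurable_def M(2,3))
  qed
  have "\<Delta> * error_prob A Q s b = (\<integral>a. \<Delta> * indicator ?B a \<partial>?M)"
    by (simp add: error_prob_def M(3) Int_absorb2)
  also have "\<dots> \<le> (\<integral>a. r a - Min (r ` A) \<partial>?M)"
    using gap by (intro integral_mono int)
      (auto simp: M(3) Min_image_oracle_actions[OF assms(4,5)] indicator_def)
  finally show ?thesis
    by (simp add: oracle_regret_def)
qed

theorem theorem1:
  fixes A :: "'a set"
    and R :: "'w \<Rightarrow> 'a \<Rightarrow> real"
    and n :: nat
    and E :: "'z measure"
    and Q :: "'w \<Rightarrow> nat \<Rightarrow> 'z measure"
    and \<theta>\<^sub>0 \<theta>\<^sub>1 :: 'w
    and a\<^sub>0 a\<^sub>1 :: 'a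
  assumes "finite A" and "A \<noteq> {}"
    and "\<And>\<theta>. prob_space (Q \<theta> n)"
    and "\<And>\<theta>. sets (Q \<theta> n) = sets E"
    and "Q \<theta>\<^sub>0 n = Q \<theta>\<^sub>1 n"
    and "oracle_actions A (R \<theta>\<^sub>0) = {a\<^sub>0}"
    and "oracle_actions A (R \<theta>\<^sub>1) = {a\<^sub>1}"
    and "a\<^sub>0 \<noteq> a\<^sub>1"
  shows "(\<forall>s \<in> selectors E A.
            1/2 * error_prob A (Q \<theta>\<^sub>0 n) s a\<^sub>0 + 1/2 * error_prob A (Q \<theta>\<^sub>1 n) s a\<^sub>1 \<ge> 1/2)
       \<and> (\<forall>\<Delta>::real. \<Delta> > 0
            \<longrightarrow> (\<forall>a\<in>A. a \<noteq> a\<^sub>0 \<longrightarrow> R \<theta>\<^sub>0 a - R \<theta>\<^sub>0 a\<^sub>0 \<ge> \<Delta>)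
            \<longrightarrow> (\<forall>a\<in>A. a \<noteq> a\<^sub>1 \<longrightarrow> R \<theta>\<^sub>1 a - R \<theta>\<^sub>1 a\<^sub>1 \<ge> \<Delta>)
            \<longrightarrow> (\<forall>s \<in> selectors E A.
                  1/2 * oracle_regret A (R \<theta>\<^sub>0) (Q \<theta>\<^sub>0 n) s
                  + 1/2 * oracle_regret A (R \<theta>\<^sub>1) (Q \<theta>\<^sub>1 n) s \<ge> \<Delta> / 2))"
proof (intro conjI ballI allI impI)
  fix s assume s: "s \<in> selectors E A"
  \<comment> \<open>Rewriting with the equality of evidence laws turns
    \<open>Q \<theta>\<^sub>0 n\<close> into \<open>Q \<theta>\<^sub>1 n\<close>, hence the instance
    at \<open>\<theta>\<^sub>1\<close>.\<close>
  show "1/2 * error_prob A (Q \<theta>\<^sub>0 n) s a\<^sub>0 + 1/2 * error_prob A (Q \<theta>\<^sub>1 n) s a\<^sub>1 \<ge> 1/2"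
    using error_prob_add_ge_1[OF assms(3,4) s assms(8), of \<theta>\<^sub>1] assms(5) by simp
next
  fix \<Delta> :: real and s
  assume \<Delta>: "\<Delta> > 0"
    and gap: "\<forall>a\<in>A. a \<noteq> a\<^sub>0 \<longrightarrow> R \<theta>\<^sub>0 a - R \<theta>\<^sub>0 a\<^sub>0 \<ge> \<Delta>"
      "\<forall>a\<in>A. a \<noteq> a\<^sub>1 \<longrightarrow> R \<theta>\<^sub>1 a - R \<theta>\<^sub>1 a\<^sub>1 \<ge> \<Delta>"
    and s: "s \<in> selectors E A"
  \<comment> \<open>Positivity of \<open>\<Delta>\<close> allows scaling the error bound.
    Distributing the product leaves one term per world, each bounded by that world's regret; halving
    the sum gives the claim.\<close>
  have "\<Delta> * 1 \<le> \<Delta> * (error_prob A (Q \<theta>\<^sub>0 n) s a\<^sub>0 + error_prob A (Q \<theta>\<^sub>1 n) s a\<^sub>1)"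
    using error_prob_add_ge_1[OF assms(3,4) s assms(8), of \<theta>\<^sub>1] assms(5) \<Delta>
    by (intro mult_left_mono) auto
  moreover have "\<Delta> * error_prob A (Q \<theta>\<^sub>0 n) s a\<^sub>0 \<le> oracle_regret A (R \<theta>\<^sub>0) (Q \<theta>\<^sub>0 n) s"
    using assms(6) by (intro oracle_regret_ge_error_prob[OF assms(3,4) s assms(1) _ gap(1)]) simp
  moreover have "\<Delta> * error_prob A (Q \<theta>\<^sub>1 n) s a\<^sub>1 \<le> oracle_regret A (R \<theta>\<^sub>1) (Q \<theta>\<^sub>1 n) s"
    using assms(7) by (intro oracle_regret_ge_error_prob[OF assms(3,4) s assms(1) _ gap(2)]) simp
  ultimately show "1/2 * oracle_regret A (R \<theta>\<^sub>0) (Q \<theta>\<^sub>0 n) s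
      + 1/2 * oracle_regret A (R \<theta>\<^sub>1) (Q \<theta>\<^sub>1 n) s \<ge> \<Delta> / 2"
    by (simp add: distrib_left)
qed

end
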